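(* A permutation $w\in S_n$ is $2$-boolean if and only if $w$ avoids the patterns $3421$, $4312$, $4321$ and $456123$.
   Context: $S_n$ is generated by the simple transpositions $s_i=(i\ i+1)$, $1\le i\le n-1$. A permutation $w$ is $k$-boolean if no reduced word (expression of minimal length in the $s_i$) of $w$ contains some $s_i$ strictly more than $k$ times. Pattern containment is classical: $w$ contains $p\in S_m$ if there are indices $r_1<\cdots<r_m$ such that $w(r_1),\ldots,w(r_m)$ are in the same relative order as $p(1),\ldots,p(m)$; otherwise $w$ avoids $p$. *)

theory Defs
  imports "HOL-Combinatorics.Permutations"
begin

text \<open>
  The symmetric group \<open>S\<^sub>n\<close> is rendered as the set of functions \<open>w\<close> with
  \<^term>\<open>w permutes {1..n}\<close>, under composition \<open>(f \<circ> g) x = f (g x)\<close>.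
\<close>

definition simple_transp :: "nat \<Rightarrow> nat \<Rightarrow> nat" where
  "simple_transp i = transpose i (Suc i)"

text \<open>The word \<open>[i\<^sub>1, \<dots>, i\<^sub>l]\<close> of indices stands for the product \<open>s i\<^sub>1 \<circ> \<dots> \<circ> s i\<^sub>l\<close>.\<close>

definition word_prod :: "nat list \<Rightarrow> nat \<Rightarrow> nat" where
  "word_prod is = foldr (\<lambda>i f. simple_transp i \<circ> f) is id"

definition is_word_of :: "nat \<Rightarrow> (nat \<Rightarrow> nat) \<Rightarrow> nat list \<Rightarrow> bool" where
  "is_word_of n w is \<longleftrightarrow> set is \<subseteq> {1..<n} \<and> word_prod is = w"

definition reduced_word :: "nat \<Rightarrow> (nat \<Rightarrow> nat) \<Rightarrow> nat list \<Rightarrow> bool" where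
  "reduced_word n w is \<longleftrightarrow>
     is_word_of n w is \<and> (\<forall>js. is_word_of n w js \<longrightarrow> length is \<le> length js)"

definition k_boolean :: "nat \<Rightarrow> nat \<Rightarrow> (nat \<Rightarrow> nat) \<Rightarrow> bool" where
  "k_boolean k n w \<longleftrightarrow>
     \<not> (\<exists>is. reduced_word n w is \<and> (\<exists>i\<in>{1..<n}. count_list is i > k))"

text \<open>One-line notation: \<open>one_line [p\<^sub>1, \<dots>, p\<^sub>m]\<close> is the function with \<open>j \<mapsto> p\<^sub>j\<close>
  for \<open>1 \<le> j \<le> m\<close>, extended by the identity as required by \<open>permutes\<close>.\<close>

definition one_line :: "nat list \<Rightarrow> nat \<Rightarrow> nat" where
  "one_line ps j = (if j \<in> {1..length ps} then ps ! (j - 1) else j)"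

lemma one_line_permutes:
  assumes "distinct ps" "set ps = {1..length ps}"
  shows "one_line ps permutes {1..length ps}"
proof (rule bij_imp_permutes)
  let ?m = "length ps"
  have "inj_on (one_line ps) {1..?m}"
    using assms(1) by (auto simp: inj_on_def one_line_def nth_eq_iff_index_eq)
  moreover have "one_line ps ` {1..?m} \<subseteq> {1..?m}"
    using assms(2) nth_mem[of _ ps] by (force simp: one_line_def)
  ultimately show "bij_betw (one_line ps) {1..?m} {1..?m}"
    by (simp add: bij_betw_def endo_inj_surj)
qed (auto simp: one_line_def)

definition contains_pattern ::
    "nat \<Rightarrow> (nat \<Rightarrow> nat) \<Rightarrow> nat \<Rightarrow> (nat \<Rightarrow> nat) \<Rightarrow> bool" where
  "contains_pattern n w m p \<longleftrightarrow>
     (\<exists>r. r ` {1..m} \<subseteq> {1..n} \<and> strict_mono_on {1..m} r \<and>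
          (\<forall>a\<in>{1..m}. \<forall>b\<in>{1..m}. w (r a) < w (r b) \<longleftrightarrow> p a < p b))"

definition avoids_pattern ::
    "nat \<Rightarrow> (nat \<Rightarrow> nat) \<Rightarrow> nat \<Rightarrow> (nat \<Rightarrow> nat) \<Rightarrow> bool" where
  "avoids_pattern n w m p \<longleftrightarrow> \<not> contains_pattern n w m p"

end

(* Multiplying s_(i_1) ... s_(i_l) out from the left, the letters s_j of a reduced word act on
   one-line notation by exchanging an ascent at the positions j, j+1. A letter s_i is the only one
   moving entries between the first i positions and the rest.

   If s_i occurs three times, follow how entries cross the line between positions i and i+1.
   After one crossing, exactly one entry has left each side. After two, either two entries have left
   each side, or one has and some entry made a detour across the line, which leaves a decreasing
   triple straddling it. A third crossing then produces one of the patterns, and further ascents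
   preserve the patterns because these are expressible by inversions alone.

   Conversely, sort w by removing descents, keeping some pattern as long as possible. When every
   descent destroys the pattern, all descents lie at adjacent descending entries of the pattern
   occurrence, so w is increasing elsewhere and has a window of consecutive positions that is
   sorted explicitly, using one letter three times. *)
theory Submission
  imports Defs
begin

section \<open>Inversions under the exchange of adjacent positions\<close>

definition inverted :: "(nat \<Rightarrow> nat) \<Rightarrow> nat \<Rightarrow> nat \<Rightarrow> bool" where
  "inverted w x y \<longleftrightarrow> x < y \<and> w y < w x"

definition inversions :: "(nat \<Rightarrow> nat) \<Rightarrow> (nat \<times> nat) set" where
  "inversions w = {(x, y). inverted w x y}"

lemma simple_transp_apply [simp]:
  "simple_transp j j = Suc j"
  "simple_transp j (Suc j) = j"
  "x \<noteq> j \<Longrightarrow> x \<noteq> Suc j \<Longrightarrow> simple_transp j x = x"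
  by (auto simp: simple_transp_def transpose_def)

lemma simple_transp_idem [simp]:
  "simple_transp j (simple_transp j x) = x"
  "w \<circ> simple_transp j \<circ> simple_transp j = w"
  by (auto simp: simple_transp_def fun_eq_iff)

lemma simple_transp_eq_iff [simp]: "simple_transp j x = simple_transp j y \<longleftrightarrow> x = y"
  by (metis simple_transp_idem(1))

lemma simple_transp_le_iff [simp]: "j \<noteq> i \<Longrightarrow> simple_transp j x \<le> i \<longleftrightarrow> x \<le> i"
  by (auto simp: simple_transp_def transpose_def)

lemma less_simple_transp_iff [simp]: "j \<noteq> i \<Longrightarrow> i < simple_transp j x \<longleftrightarrow> i < x"
  by (auto simp: simple_transp_def transpose_def)

lemma simple_transp_less:
  "x < y \<Longrightarrow> (x, y) \<noteq> (j, Suc j) \<Longrightarrow> simple_transp j x < simple_transp j y"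
  by (auto simp: simple_transp_def transpose_def)

lemma simple_transp_permutes: "j \<in> {1..<n} \<Longrightarrow> simple_transp j permutes {1..n}"
  unfolding simple_transp_def by (rule permutes_swap_id) auto

lemma comp_simple_transp_permutes:
  "w permutes {1..n} \<Longrightarrow> j \<in> {1..<n} \<Longrightarrow> w \<circ> simple_transp j permutes {1..n}"
  by (rule permutes_compose[OF simple_transp_permutes])

text \<open>The entry at position \<open>x\<close> travels to position
  \<open>simple_transp j x\<close>, and \<open>simple_transp j\<close> reverses the order of no pair
  of positions except \<open>j\<close> and \<open>Suc j\<close>.\<close>

lemma inverted_comp_simple_transp:
  "inverted w x y \<Longrightarrow> (x, y) \<noteq> (j, Suc j) \<Longrightarrow>
   inverted (w \<circ> simple_transp j) (simple_transp j x) (simple_transp j y)"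
  unfolding inverted_def by (auto intro: simple_transp_less)

lemma inverted_ascent:
  "inverted w x y \<Longrightarrow> w j < w (Suc j) \<Longrightarrow>
   inverted (w \<circ> simple_transp j) (simple_transp j x) (simple_transp j y)"
  by (rule inverted_comp_simple_transp) (auto simp: inverted_def)

text \<open>Positions outside \<open>{1..n}\<close> are fixed; 0 lies below and every number beyond
  \<open>n\<close> above all values in the range, so such a fixed point is inverted with
  nothing.\<close>

lemma inverted_in_range:
  assumes "w permutes {1..n}" "inverted w x y"
  shows "x \<in> {1..n}" "y \<in> {1..n}"
proof -
  have w: "w z \<in> {1..n} \<longleftrightarrow> z \<in> {1..n}" "z \<notin> {1..n} \<Longrightarrow> w z = z" for z
    using assms(1) permutes_in_image permutes_not_in by metis+
  have xy: "x < y" "w y < w x" using assms(2) by (auto simp: inverted_def)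
  have y: "y \<le> n"
    using w[of y] w[of x] xy by (metis atLeastAtMost_iff le_trans less_le_not_le nat_le_linear not_less)
  moreover have "1 \<le> x"
    using w[of x] xy by (metis atLeastAtMost_iff less_one not_le not_less_zero)
  ultimately show "x \<in> {1..n}" "y \<in> {1..n}" using xy by auto
qed

lemma finite_inversions: "w permutes {1..n} \<Longrightarrow> finite (inversions w)"
  by (rule finite_subset[of _ "{1..n} \<times> {1..n}"])
     (use inverted_in_range[of w n] in \<open>auto simp: inversions_def\<close>)

lemma inversions_ascent:
  assumes "w j < w (Suc j)"
  shows "inversions (w \<circ> simple_transp j) =
    insert (j, Suc j) (map_prod (simple_transp j) (simple_transp j) ` inversions w)" (is "?L = ?R")
proof (rule set_eqI, clarify)
  fix x y
  let ?s = "simple_transp j"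
  show "(x, y) \<in> ?L \<longleftrightarrow> (x, y) \<in> ?R"
  proof
    assume "(x, y) \<in> ?L"
    then have I: "inverted (w \<circ> ?s) x y" by (simp add: inversions_def)
    show "(x, y) \<in> ?R"
    proof (cases "(x, y) = (j, Suc j)")
      case False
      with I have "inverted w (?s x) (?s y)"
        using inverted_comp_simple_transp[OF I False] by simp
      then have "(?s x, ?s y) \<in> inversions w" by (simp add: inversions_def)
      then have "map_prod ?s ?s (?s x, ?s y) \<in> map_prod ?s ?s ` inversions w" by (rule imageI)
      then show ?thesis by simp
    qed simp
  next
    assume "(x, y) \<in> ?R"
    then show "(x, y) \<in> ?L"
      using assms inverted_ascent[OF _ assms]
      by (auto simp: inversions_def) (simp add: inverted_def)
  qed
qed

text \<open>The relabelling of old inversions is injective and misses \<open>(j, Suc j)\<close>,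
  whose only possible source is \<open>(Suc j, j)\<close>, not an increasing pair. So exactly one
  inversion is gained.\<close>

lemma card_inversions_ascent:
  assumes "w permutes {1..n}" "w j < w (Suc j)"
  shows "card (inversions (w \<circ> simple_transp j)) = Suc (card (inversions w))"
proof -
  let ?f = "map_prod (simple_transp j) (simple_transp j)"
  have "(j, Suc j) \<notin> ?f ` inversions w"
  proof
    assume "(j, Suc j) \<in> ?f ` inversions w"
    then obtain x y where xy: "inverted w x y" "simple_transp j x = j" "simple_transp j y = Suc j"
      by (auto simp: inversions_def)
    then have "x = Suc j" "y = j"
      by (metis simple_transp_apply(2) simple_transp_eq_iff, metis simple_transp_apply(1) simple_transp_eq_iff xy(3))
    with xy(1) show False by (simp add: inverted_def)
  qed
  moreover have "inj_on ?f (inversions w)"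
    by (auto simp: inj_on_def)
  ultimately show ?thesis
    using finite_inversions[OF assms(1)] by (simp add: inversions_ascent[OF assms(2)] card_image)
qed

lemma card_inversions_descent:
  assumes "w permutes {1..n}" "j \<in> {1..<n}" "w (Suc j) < w j"
  shows "card (inversions w) = Suc (card (inversions (w \<circ> simple_transp j)))"
  using card_inversions_ascent[OF comp_simple_transp_permutes[OF assms(1,2)], of j] assms(3) by simp

lemma permutes_ascent_or_descent:
  "w permutes A \<Longrightarrow> w j < w (Suc j) \<or> w (Suc j) < w (j :: nat)"
  by (metis n_not_Suc_n nat_neq_iff permutes_inj injD)

lemma descent_in_range:
  "w permutes {1..n} \<Longrightarrow> w (Suc j) < w j \<Longrightarrow> j \<in> {1..<n}"
  using inverted_in_range[of w n j "Suc j"] by (auto simp: inverted_def)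

section \<open>Words, and reduced length as the number of inversions\<close>

lemma word_prod_Nil [simp]: "word_prod [] = id"
  by (simp add: word_prod_def)

lemma word_prod_append: "word_prod (is @ [j]) = word_prod is \<circ> simple_transp j"
  by (induction "is") (auto simp: word_prod_def fun_eq_iff)

lemma word_prod_permutes: "set is \<subseteq> {1..<n} \<Longrightarrow> word_prod is permutes {1..n}"
proof (induction "is" rule: rev_induct)
  case Nil
  show ?case by (simp only: word_prod_Nil permutes_id)
next
  case (snoc j "is")
  then show ?case by (simp only: word_prod_append) (rule comp_simple_transp_permutes, auto)
qed

text \<open>Each letter exchanges two adjacent positions and so changes the number of inversions by
  exactly one, up or down.\<close>

lemma card_inversions_le_length:
  "set is \<subseteq> {1..<n} \<Longrightarrow> card (inversions (word_prod is)) \<le> length is"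
proof (induction "is" rule: rev_induct)
  case Nil
  have "inversions id = {}" by (auto simp: inversions_def inverted_def)
  then show ?case by (simp only: word_prod_Nil) simp
next
  case (snoc j "is")
  let ?u = "word_prod is"
  have u: "?u permutes {1..n}" and j: "j \<in> {1..<n}"
    using snoc.prems word_prod_permutes[of "is" n] by auto
  have IH: "card (inversions ?u) \<le> length is" using snoc by simp
  from permutes_ascent_or_descent[OF u, of j]
  have "card (inversions (?u \<circ> simple_transp j)) \<le> Suc (length is)"
  proof
    assume "?u j < ?u (Suc j)"
    from card_inversions_ascent[OF u this] IH show ?thesis by linarith
  next
    assume "?u (Suc j) < ?u j"
    from card_inversions_descent[OF u j this] IH show ?thesis by linarith
  qed
  then show ?case by (simp only: word_prod_append length_append_singleton)
qed

text \<open>A strictly increasing map on the naturals satisfies \<open>x \<le> w x\<close>. The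
  inverse is increasing too, which gives the opposite inequality.\<close>

lemma ascending_imp_id:
  assumes "w permutes {1..n}" "\<And>j. w j < w (Suc j)"
  shows "w = id"
proof -
  have "strict_mono w" using assms(2) by (simp add: strict_mono_Suc_iff)
  moreover have "strict_mono (inv w)"
    using \<open>strict_mono w\<close> permutes_inverses(1)[OF assms(1)]
    by (intro strict_monoI) (metis strict_mono_less)
  ultimately have "x \<le> w x" "x \<le> inv w x" for x by (auto intro: strict_mono_imp_increasing)
  then have "w x = x" for x
    by (metis assms(1) order_antisym permutes_inverses(2))
  then show ?thesis by auto
qed

text \<open>Bubble sort: as long as inversions remain there is a descent, and removing it costs one
  letter and one inversion.\<close>

lemma word_of_inversion_length:
  "w permutes {1..n} \<Longrightarrow> \<exists>is. is_word_of n w is \<and> length is = card (inversions w)"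
proof (induction "card (inversions w)" arbitrary: w)
  case 0
  have "w j < w (Suc j)" for j
    using permutes_ascent_or_descent[OF 0(2), of j] 0 finite_inversions[OF 0(2)]
    by (auto simp: inversions_def inverted_def)
  then have "w = id" using ascending_imp_id[OF 0(2)] by blast
  then have "is_word_of n w []" by (simp only: is_word_of_def word_prod_Nil) simp
  then show ?case using 0(1) by (metis list.size(3))
next
  case (Suc m)
  obtain j where j: "w (Suc j) < w j"
  proof (rule ccontr)
    assume "\<not> thesis"
    then have "w = id"
      using that ascending_imp_id[OF Suc.prems] permutes_ascent_or_descent[OF Suc.prems] by blast
    then have "inversions w = {}" by (auto simp: inversions_def inverted_def)
    with Suc.hyps(2) show False by simp
  qed
  have jn: "j \<in> {1..<n}" by (rule descent_in_range[OF Suc.prems j])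
  let ?u = "w \<circ> simple_transp j"
  have "m = card (inversions ?u)" using card_inversions_descent[OF Suc.prems jn j] Suc.hyps(2) by simp
  from Suc.hyps(1)[OF this comp_simple_transp_permutes[OF Suc.prems jn]]
  obtain "is" where "is": "is_word_of n ?u is" "length is = card (inversions ?u)" by blast
  then have "is_word_of n w (is @ [j])" using jn by (auto simp: is_word_of_def word_prod_append)
  moreover have "length (is @ [j]) = card (inversions w)"
    using "is"(2) card_inversions_descent[OF Suc.prems jn j] by simp
  ultimately show ?case by blast
qed

text \<open>The two preceding bounds meet, which turns minimality among all words into a count that
  can be followed letter by letter.\<close>

lemma reduced_word_iff:
  assumes "w permutes {1..n}"
  shows "reduced_word n w is \<longleftrightarrow> is_word_of n w is \<and> length is = card (inversions w)"
  using word_of_inversion_length[OF assms] card_inversions_le_length[of _ n]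
  unfolding reduced_word_def is_word_of_def by (metis le_antisym)

text \<open>If \<open>j\<close> were an ascent of \<open>w\<close>, the word without its last letter
  would yield more inversions than it has letters.\<close>

lemma reduced_word_snocD:
  assumes "w permutes {1..n}" "reduced_word n w (is @ [j])"
  shows "j \<in> {1..<n}" "w (Suc j) < w j" "reduced_word n (w \<circ> simple_transp j) is"
proof -
  let ?u = "word_prod is"
  have len: "Suc (length is) = card (inversions w)" and w: "w = ?u \<circ> simple_transp j"
    and set: "set is \<subseteq> {1..<n}" "j \<in> {1..<n}"
    using assms(2) by (auto simp: reduced_word_iff[OF assms(1)] is_word_of_def word_prod_append)
  have u: "?u permutes {1..n}" "?u = w \<circ> simple_transp j" using word_prod_permutes[OF set(1)] by (simp_all add: w)
  have le: "card (inversions ?u) \<le> length is" by (rule card_inversions_le_length[OF set(1)])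
  show "j \<in> {1..<n}" by (rule set)
  have "?u j < ?u (Suc j)"
    using permutes_ascent_or_descent[OF u(1), of j] card_inversions_descent[OF u(1) set(2)] le len w
    by auto
  then show "w (Suc j) < w j" by (simp add: w)
  with card_inversions_descent[OF assms(1) set(2)] len u
  show "reduced_word n (w \<circ> simple_transp j) is"
    using reduced_word_iff[OF u(1)] set(1) by (auto simp: is_word_of_def)
qed

lemma reduced_word_snocI:
  assumes "w permutes {1..n}" "w (Suc j) < w j" "reduced_word n (w \<circ> simple_transp j) is"
  shows "reduced_word n w (is @ [j])"
proof -
  note j = descent_in_range[OF assms(1,2)]
  show ?thesis
    using assms card_inversions_descent[OF assms(1) j assms(2)] j
    by (auto simp: reduced_word_iff[OF assms(1)] reduced_word_iff[OF comp_simple_transp_permutes[OF assms(1) j]]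
        is_word_of_def word_prod_append)
qed

section \<open>Patterns expressed by inversions\<close>

text \<open>The patterns are phrased by inversions only, leaving all other relative orders open, so that they
  persist under exchanging an ascent: \<open>pat4\<close> unites 3421, 4312 and 4321, and \<open>pat6\<close> says that
  three entries precede three smaller ones, in whatever order within the two triples.\<close>

definition pat4 :: "(nat \<Rightarrow> nat) \<Rightarrow> bool" where
  "pat4 w \<longleftrightarrow> (\<exists>a b c d. a \<noteq> b \<and> c \<noteq> d \<and>
     inverted w a c \<and> inverted w a d \<and> inverted w b c \<and> inverted w b d \<and>
     (inverted w a b \<or> inverted w c d))"

definition pat6 :: "(nat \<Rightarrow> nat) \<Rightarrow> bool" where
  "pat6 w \<longleftrightarrow> (\<exists>a b c d e f. distinct [a, b, c] \<and> distinct [d, e, f] \<and>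
     (\<forall>x\<in>{a, b, c}. \<forall>y\<in>{d, e, f}. inverted w x y))"

lemma pat4_ascent: "pat4 w \<Longrightarrow> w j < w (Suc j) \<Longrightarrow> pat4 (w \<circ> simple_transp j)"
  unfolding pat4_def using inverted_ascent[of w _ _ j] by (metis simple_transp_eq_iff)

lemma pat6I:
  "distinct [a, b, c] \<Longrightarrow> distinct [d, e, f] \<Longrightarrow>
   (\<And>x y. x \<in> {a, b, c} \<Longrightarrow> y \<in> {d, e, f} \<Longrightarrow> inverted w x y) \<Longrightarrow> pat6 w"
  unfolding pat6_def by blast

lemma pat6E:
  assumes "pat6 w"
  obtains a b c d e f where "distinct [a, b, c]" "distinct [d, e, f]"
    "\<And>x y. x \<in> {a, b, c} \<Longrightarrow> y \<in> {d, e, f} \<Longrightarrow> inverted w x y"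
  using assms unfolding pat6_def by blast

text \<open>Only the inversions of one occurrence are assumed to survive, so this serves both for
  ascents and for descents that do not harm the occurrence.\<close>

lemma pat6_comp_simple_transp:
  assumes "distinct [a, b, c]" "distinct [d, e, f]"
    "\<And>x y. x \<in> {a, b, c} \<Longrightarrow> y \<in> {d, e, f} \<Longrightarrow>
      inverted (w \<circ> simple_transp j) (simple_transp j x) (simple_transp j y)"
  shows "pat6 (w \<circ> simple_transp j)"
proof (rule pat6I)
  let ?s = "simple_transp j"
  show "distinct [?s a, ?s b, ?s c]" "distinct [?s d, ?s e, ?s f]" using assms(1,2) by simp_all
  fix x y
  assume "x \<in> {?s a, ?s b, ?s c}" "y \<in> {?s d, ?s e, ?s f}"
  then have "?s x \<in> {a, b, c}" "?s y \<in> {d, e, f}" by auto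
  from assms(3)[OF this] show "inverted (w \<circ> ?s) x y" by (simp only: simple_transp_idem)
qed

lemma pat6_ascent:
  assumes "pat6 w" "w j < w (Suc j)"
  shows "pat6 (w \<circ> simple_transp j)"
proof -
  from assms(1) obtain a b c d e f where "distinct [a, b, c]" "distinct [d, e, f]"
    and "\<And>x y. x \<in> {a, b, c} \<Longrightarrow> y \<in> {d, e, f} \<Longrightarrow> inverted w x y"
    by (rule pat6E) blast
  then show ?thesis
    using inverted_ascent[OF _ assms(2)] by (intro pat6_comp_simple_transp[of a b c d e f]) blast+
qed

section \<open>From a pattern to a reduced word using a letter three times\<close>

text \<open>The bound is "at least", so it persists when further letters are appended to the
  word.\<close>

definition occurs_in_reduced :: "nat \<Rightarrow> nat \<Rightarrow> nat \<Rightarrow> (nat \<Rightarrow> nat) \<Rightarrow> bool" where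
  "occurs_in_reduced n i m w \<longleftrightarrow> (\<exists>is. reduced_word n w is \<and> m \<le> count_list is i)"

lemma occurs_in_reduced_0: "w permutes {1..n} \<Longrightarrow> occurs_in_reduced n i 0 w"
  using word_of_inversion_length[of w n] reduced_word_iff[of w n]
  by (auto simp: occurs_in_reduced_def)

lemma occurs_in_reduced_descent:
  assumes "w permutes {1..n}" "w (Suc j) < w j" "occurs_in_reduced n i m (w \<circ> simple_transp j)"
  shows "occurs_in_reduced n i (m + (if i = j then 1 else 0)) w"
proof -
  obtain "is" where "is": "reduced_word n (w \<circ> simple_transp j) is" "m \<le> count_list is i"
    using assms(3) by (auto simp: occurs_in_reduced_def)
  show ?thesis
    unfolding occurs_in_reduced_def
    by (rule exI[of _ "is @ [j]"]) (use "is" reduced_word_snocI[OF assms(1,2)] in auto)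
qed

text \<open>Letters are listed in the order of removal, that is, from the end of the word backwards:
  a reduced word of \<open>w\<close> ends in \<open>rev js\<close>. Counts do not see the
  reversal.\<close>

fun descent_chain :: "(nat \<Rightarrow> nat) \<Rightarrow> nat list \<Rightarrow> bool" where
  "descent_chain w [] \<longleftrightarrow> True"
| "descent_chain w (j # js) \<longleftrightarrow> w (Suc j) < w j \<and> descent_chain (w \<circ> simple_transp j) js"

lemma descent_chain_occurs:
  "w permutes {1..n} \<Longrightarrow> descent_chain w js \<Longrightarrow> occurs_in_reduced n i (count_list js i) w"
proof (induction js arbitrary: w)
  case Nil
  then show ?case by (simp add: occurs_in_reduced_0)
next
  case (Cons j js)
  have j: "w (Suc j) < w j" and c: "descent_chain (w \<circ> simple_transp j) js"
    using Cons.prems(2) by (simp_all only: descent_chain.simps)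
  note jn = descent_in_range[OF Cons.prems(1) j]
  from occurs_in_reduced_descent[OF Cons.prems(1) j
      Cons.IH[OF comp_simple_transp_permutes[OF Cons.prems(1) jn] c]]
  show ?case by (simp split: if_splits)
qed

text \<open>For entries A > B > C, D the chain runs ABCD, ACBD, CABD, CBAD, CBDA, CDBA. It never
  compares C with D, so one chain covers both orders.\<close>

lemma occurs_contiguous_top:
  assumes "w permutes {1..n}" "w (Suc k) < w k" "w (k + 2) < w (Suc k)" "w (k + 3) < w (Suc k)"
  shows "occurs_in_reduced n (Suc k) 3 w"
proof -
  let ?js = "[k + 1, k, k + 1, k + 2, k + 1]"
  have "descent_chain w ?js"
    using assms(2-4) by (simp add: numeral_eq_Suc)
  from descent_chain_occurs[OF assms(1) this, of "Suc k"] show ?thesis by (simp add: numeral_eq_Suc)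
qed

text \<open>For entries A, B > C > D the chain runs ABCD, ACBD, ACDB, ADCB, DACB, DCAB, never
  comparing A with B.\<close>

lemma occurs_contiguous_bottom:
  assumes "w permutes {1..n}" "w (k + 2) < w k" "w (k + 2) < w (Suc k)" "w (k + 3) < w (k + 2)"
  shows "occurs_in_reduced n (Suc k) 3 w"
proof -
  let ?js = "[k + 1, k + 2, k + 1, k, k + 1]"
  have "descent_chain w ?js"
    using assms(2-4) by (simp add: numeral_eq_Suc)
  from descent_chain_occurs[OF assms(1) this, of "Suc k"] show ?thesis by (simp add: numeral_eq_Suc)
qed

text \<open>The nine exchanges pass each of the three larger entries over each of the three smaller
  ones, without comparing entries within a triple.\<close>

lemma occurs_contiguous_456123:
  assumes "w permutes {1..n}"
    "\<And>x y. x \<in> {k, k + 1, k + 2} \<Longrightarrow> y \<in> {k + 3, k + 4, k + 5} \<Longrightarrow> w y < w x"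
  shows "occurs_in_reduced n (k + 2) 3 w"
proof -
  let ?js = "[k + 2, k + 1, k + 3, k + 2, k, k + 4, k + 1, k + 3, k + 2]"
  have "descent_chain w ?js"
    using assms(2) by (simp add: numeral_eq_Suc)
  from descent_chain_occurs[OF assms(1) this, of "k + 2"] show ?thesis by (simp add: numeral_eq_Suc)
qed

lemma ascending_between:
  fixes w :: "nat \<Rightarrow> nat"
  assumes "x \<le> y" "\<And>j. x \<le> j \<Longrightarrow> j < y \<Longrightarrow> w j < w (Suc j)"
  shows "w x \<le> w y"
  using assms
proof (induction y rule: dec_induct)
  case (step y)
  then show ?case by (meson less_SucI less_Suc_eq le_less_trans less_imp_le lessI)
qed simp

lemma pat4_sorted:
  assumes "pat4 w"
  obtains a b c d where "a < b" "b < c" "c < d" "w c < w a" "w c < w b" "w d < w a" "w d < w b"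
    "w b < w a \<or> w d < w c"
proof -
  from assms obtain a b c d where *: "a \<noteq> b" "c \<noteq> d"
     "inverted w a c" "inverted w a d" "inverted w b c" "inverted w b d"
     "inverted w a b \<or> inverted w c d" unfolding pat4_def by blast
  consider "a < b" "c < d" | "a < b" "d < c" | "b < a" "c < d" | "b < a" "d < c"
    using * by linarith
  then show thesis
  proof cases
    case 1
    with * that[of a b c d] show thesis by (simp add: inverted_def)
  next
    case 2
    with * that[of a b d c] show thesis by (simp add: inverted_def)
  next
    case 3
    with * that[of b a c d] show thesis by (simp add: inverted_def)
  next
    case 4
    with * that[of b a d c] show thesis by (simp add: inverted_def)
  qed
qed

lemma distinct3_sort:
  assumes "distinct [a, b, c :: nat]"
  obtains x y z where "x < y" "y < z" "{a, b, c} = {x, y, z}"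
proof -
  have "\<exists>x y z. x < y \<and> y < z \<and> {a, b, c} = {x, y, z}"
  proof -
    consider "a < b" "b < c" | "a < c" "c < b" | "b < a" "a < c" | "b < c" "c < a"
      | "c < a" "a < b" | "c < b" "b < a" using assms by fastforce
    then show ?thesis by cases blast+
  qed
  then show thesis using that by blast
qed

lemma pat6_sorted:
  assumes "pat6 w"
  obtains a b c d e f where "a < b" "b < c" "c < d" "d < e" "e < f"
    "\<And>x y. x \<in> {a, b, c} \<Longrightarrow> y \<in> {d, e, f} \<Longrightarrow> w y < w x"
proof -
  from assms obtain a b c d e f where d: "distinct [a, b, c]" "distinct [d, e, f]" and
    I: "\<And>x y. x \<in> {a, b, c} \<Longrightarrow> y \<in> {d, e, f} \<Longrightarrow> inverted w x y"
    by (rule pat6E) blast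
  obtain a' b' c' where s: "a' < b'" "b' < c'" "{a, b, c} = {a', b', c'}"
    using distinct3_sort[OF d(1)] .
  obtain d' e' f' where t: "d' < e'" "e' < f'" "{d, e, f} = {d', e', f'}"
    using distinct3_sort[OF d(2)] .
  note I' = I[unfolded s(3) t(3)]
  show thesis
    by (rule that[OF s(1,2) _ t(1,2)]) (use I' in \<open>auto simp: inverted_def\<close>)
qed

lemma descent_between:
  assumes "w permutes A" "x < y" "w y < (w x :: nat)"
  obtains j where "x \<le> j" "j < y" "w (Suc j) < w j"
proof -
  have "\<exists>j. x \<le> j \<and> j < y \<and> w (Suc j) < w j"
  proof (rule ccontr)
    assume "\<not> ?thesis"
    then have "w j < w (Suc j)" if "x \<le> j" "j < y" for j
      using that permutes_ascent_or_descent[OF assms(1), of j] by blast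
    then have "w x \<le> w y" using ascending_between[OF less_imp_le[OF assms(2)]] by blast
    with assms(3) show False by simp
  qed
  then show thesis using that by blast
qed

lemma pat4_minimal_contiguous:
  assumes w: "w permutes {1..n}" and "pat4 w"
    and H: "\<And>j. w (Suc j) < w j \<Longrightarrow> \<not> pat4 (w \<circ> simple_transp j)"
  shows "\<exists>i. occurs_in_reduced n i 3 w"
proof -
  obtain a b c d where o: "a < b" "b < c" "c < d" and
    v: "w c < w a" "w c < w b" "w d < w a" "w d < w b" "w b < w a \<or> w d < w c"
    using pat4_sorted[OF assms(2)] by metis
  \<comment> \<open>Removing any other descent would keep the order of the positions
    \<open>a\<close>, \<open>b\<close>, \<open>c\<close>, \<open>d\<close>, hence all inversions of
    the occurrence, against \<open>H\<close>.\<close>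
  have D: "(j, Suc j) \<in> {(a, b), (b, c), (c, d)}" if j: "w (Suc j) < w j" for j
  proof (rule ccontr)
    let ?s = "simple_transp j"
    assume "(j, Suc j) \<notin> {(a, b), (b, c), (c, d)}"
    then have "inverted (w \<circ> ?s) (?s x) (?s y)"
      if "inverted w x y" "x \<in> {a, b, c, d}" "y \<in> {a, b, c, d}" for x y
      using that o by (intro inverted_comp_simple_transp) auto
    then have "pat4 (w \<circ> ?s)"
      unfolding pat4_def using o v
      by - (rule exI[of _ "?s a"], rule exI[of _ "?s b"], rule exI[of _ "?s c"],
            rule exI[of _ "?s d"], (auto simp: inverted_def))
    with H[OF j] show False ..
  qed
  \<comment> \<open>An inversion between neighbouring entries of the occurrence forces a descent
    between them, and \<open>D\<close> leaves room for it only if they are adjacent.\<close>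
  have adj: "y = Suc x" if "(x, y) \<in> {(a, b), (b, c), (c, d)}" "w y < w x" for x y
  proof -
    have "x < y" using that o by auto
    from w this that(2) obtain j where "x \<le> j" "j < y" "w (Suc j) < w j" by (rule descent_between)
    with D[of j] that(1) o show ?thesis by auto
  qed
  have asc: "w j < w (Suc j)" if "(j, Suc j) \<notin> {(a, b), (b, c), (c, d)}" for j
    using D[of j] that permutes_ascent_or_descent[OF w, of j] by blast
  have c: "c = Suc b" using adj[of b c] v by simp
  show ?thesis
  proof (cases "w b < w a")
    case True
    then have b: "b = Suc a" using adj[of a b] by simp
    \<comment> \<open>The fourth entry of the window need not be \<open>d\<close>: if
      \<open>w c < w d\<close>, the entries ascend from \<open>Suc c\<close> to \<open>d\<close>, so
      the one at \<open>Suc c\<close> is small enough as well.\<close>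
    have "w (a + 3) < w (Suc a)"
    proof (cases "w d < w c")
      case True
      then have "d = a + 3" using adj[of c d] b c by simp
      then show ?thesis using v b by simp
    next
      case False
      have "w (Suc c) \<le> w d"
        by (rule ascending_between) (use o c b False D in \<open>auto intro!: asc\<close>)
      then show ?thesis using v b c by (simp add: numeral_eq_Suc)
    qed
    then show ?thesis
      using occurs_contiguous_top[OF w, of a] True v b c by (auto simp: numeral_eq_Suc)
  next
    case False
    then have d: "d = Suc c" using adj[of c d] v by simp
    \<comment> \<open>Nothing makes \<open>a\<close> adjacent to \<open>b\<close>, but the entries
      ascend from \<open>a\<close> to \<open>b - 1\<close>, so \<open>b - 1\<close> can replace
      \<open>a\<close> in the window.\<close>
    have "w a \<le> w (b - 1)"
      by (rule ascending_between) (use o in \<open>auto intro!: asc\<close>)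
    then have "w c < w (b - 1)" using v by simp
    moreover obtain k where "b = Suc k" using o by (metis less_imp_Suc_add)
    ultimately show ?thesis
      using occurs_contiguous_bottom[OF w, of k] False v c d by (auto simp: numeral_eq_Suc)
  qed
qed

lemma pat6_minimal_contiguous:
  assumes w: "w permutes {1..n}" and "pat6 w" and "\<not> pat4 w"
    and H: "\<And>j. w (Suc j) < w j \<Longrightarrow> \<not> pat6 (w \<circ> simple_transp j)"
  shows "\<exists>i. occurs_in_reduced n i 3 w"
proof -
  obtain a b c d e f where o: "a < b" "b < c" "c < d" "d < e" "e < f" and
    v: "\<And>x y. x \<in> {a, b, c} \<Longrightarrow> y \<in> {d, e, f} \<Longrightarrow> w y < w x"
    using pat6_sorted[OF assms(2)] by metis
  \<comment> \<open>The pair \<open>(c, d)\<close> is the only pair in the required inversions that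
    can be adjacent, so any other descent could be removed without loss.\<close>
  have D: "j = c \<and> d = Suc c" if j: "w (Suc j) < w j" for j
  proof (rule ccontr)
    let ?s = "simple_transp j"
    assume *: "\<not> (j = c \<and> d = Suc c)"
    have "inverted (w \<circ> ?s) (?s x) (?s y)" if "x \<in> {a, b, c}" "y \<in> {d, e, f}" for x y
      using that o v[OF that] * by (intro inverted_comp_simple_transp) (auto simp: inverted_def)
    moreover have "distinct [a, b, c]" "distinct [d, e, f]" using o by auto
    ultimately have "pat6 (w \<circ> ?s)" by (intro pat6_comp_simple_transp[of a b c d e f])
    with H[OF j] show False ..
  qed
  have "w d < w c" using v by simp
  with w o(3) obtain j where "w (Suc j) < w j" by (rule descent_between)
  with D have d: "d = Suc c" by blast
  have asc: "w x \<le> w y" if xy: "x \<le> y" "y \<le> c \<or> c < x" for x y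
  proof (rule ascending_between[OF xy(1)])
    fix j
    assume "x \<le> j" "j < y"
    with xy(2) have "j \<noteq> c" by auto
    then show "w j < w (Suc j)" using D[of j] permutes_ascent_or_descent[OF w, of j] by blast
  qed
  obtain k where k: "c = k + 2" using o by (intro that[of "c - 2"]) auto
  \<comment> \<open>With a single descent at \<open>c\<close>, the entries ascend on both sides of
    it. The last three before it are at least \<open>w a\<close> and the first three after it at
    most \<open>w f\<close>, so they form a contiguous occurrence.\<close>
  have "w a \<le> w x" if "x \<in> {k, k + 1, k + 2}" for x
    using that o k by (intro asc) auto
  moreover have "w y \<le> w f" if "y \<in> {k + 3, k + 4, k + 5}" for y
    using that o k d by (intro asc) auto
  ultimately have "w y < w x" if "x \<in> {k, k + 1, k + 2}" "y \<in> {k + 3, k + 4, k + 5}" for x y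
    using v[of a f] that by (meson insertI1 insertI2 le_less_trans less_le_trans)
  from occurs_contiguous_456123[OF w this] show ?thesis by blast
qed

text \<open>Induction on the number of inversions: a descent whose removal keeps a pattern is
  removed, and appending its letter afterwards cannot lower a count. Once no such descent is left, a
  minimal case applies.\<close>

lemma pat_occurs:
  "w permutes {1..n} \<Longrightarrow> pat4 w \<or> pat6 w \<Longrightarrow> \<exists>i. occurs_in_reduced n i 3 w"
proof (induction "card (inversions w)" arbitrary: w rule: less_induct)
  case less
  show ?case
  proof (cases "\<exists>j. w (Suc j) < w j \<and> (pat4 (w \<circ> simple_transp j) \<or> pat6 (w \<circ> simple_transp j))")
    case True
    then obtain j where j: "w (Suc j) < w j"
      and p: "pat4 (w \<circ> simple_transp j) \<or> pat6 (w \<circ> simple_transp j)" by blast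
    note jn = descent_in_range[OF less.prems(1) j]
    have "card (inversions (w \<circ> simple_transp j)) < card (inversions w)"
      using card_inversions_descent[OF less.prems(1) jn j] by linarith
    from less.hyps[OF this comp_simple_transp_permutes[OF less.prems(1) jn] p]
    obtain i where "occurs_in_reduced n i 3 (w \<circ> simple_transp j)" ..
    from occurs_in_reduced_descent[OF less.prems(1) j this] show ?thesis
      unfolding occurs_in_reduced_def by (meson le_add1 le_trans)
  next
    case False
    then show ?thesis
      using less.prems pat4_minimal_contiguous[OF less.prems(1)] pat6_minimal_contiguous[OF less.prems(1)]
      by blast
  qed
qed

section \<open>Entries crossing the line between positions \<open>i\<close> and
  \<open>Suc i\<close>\<close>

text \<open>Crossers are measured against the identity, so an entry that has gone across and back is
  not among them. They are recorded by position.\<close>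

definition up_crossers :: "nat \<Rightarrow> (nat \<Rightarrow> nat) \<Rightarrow> nat set" where
  "up_crossers i w = {x. x \<le> i \<and> i < w x}"

definition down_crossers :: "nat \<Rightarrow> (nat \<Rightarrow> nat) \<Rightarrow> nat set" where
  "down_crossers i w = {x. i < x \<and> w x \<le> i}"

lemma crossers_inverted:
  "x \<in> up_crossers i w \<Longrightarrow> y \<in> down_crossers i w \<Longrightarrow> inverted w x y"
  by (auto simp: up_crossers_def down_crossers_def inverted_def)

lemma simple_transp_image_iff: "x \<in> simple_transp j ` A \<longleftrightarrow> simple_transp j x \<in> A"
  by (metis image_iff simple_transp_idem(1))

lemma crossers_comp_other:
  assumes "j \<noteq> i"
  shows "up_crossers i (w \<circ> simple_transp j) = simple_transp j ` up_crossers i w"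
    and "down_crossers i (w \<circ> simple_transp j) = simple_transp j ` down_crossers i w"
  using assms by (auto simp: up_crossers_def down_crossers_def simple_transp_image_iff)

text \<open>Position \<open>i\<close> now holds the old \<open>w (Suc i)\<close>, which is at most
  \<open>i\<close> exactly when \<open>Suc i\<close> was a down crosser; dually for position
  \<open>Suc i\<close>.\<close>

lemma crossers_comp_same:
  "up_crossers i (w \<circ> simple_transp i) =
    up_crossers i w - {i} \<union> (if Suc i \<in> down_crossers i w then {} else {i})"
  "down_crossers i (w \<circ> simple_transp i) =
    down_crossers i w - {Suc i} \<union> (if i \<in> up_crossers i w then {} else {Suc i})"
  by (auto simp: up_crossers_def down_crossers_def simple_transp_def transpose_def split: if_splits)

definition one_crossing :: "nat \<Rightarrow> (nat \<Rightarrow> nat) \<Rightarrow> bool" where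
  "one_crossing i w \<longleftrightarrow> (\<exists>p q. up_crossers i w = {p} \<and> down_crossers i w = {q})"

definition two_crossings :: "nat \<Rightarrow> (nat \<Rightarrow> nat) \<Rightarrow> bool" where
  "two_crossings i w \<longleftrightarrow>
     (\<exists>p p' q q'. p \<noteq> p' \<and> q \<noteq> q' \<and> up_crossers i w = {p, p'} \<and> down_crossers i w = {q, q'})"

text \<open>The two ways in which the second crossing undoes half of the first: the large entry that had
  crossed is displaced by a larger one (\<open>upper_detour\<close>), or the small entry that had crossed is
  displaced by a smaller one (\<open>lower_detour\<close>); it now sits at position \<open>q\<close>.\<close>

definition upper_detour :: "nat \<Rightarrow> (nat \<Rightarrow> nat) \<Rightarrow> bool" where
  "upper_detour i w \<longleftrightarrow>
     (\<exists>p q r. up_crossers i w = {p} \<and> down_crossers i w = {r} \<and> i < q \<and> q < r \<and> i < w q \<and> w q < w p)"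

definition lower_detour :: "nat \<Rightarrow> (nat \<Rightarrow> nat) \<Rightarrow> bool" where
  "lower_detour i w \<longleftrightarrow>
     (\<exists>p q r. up_crossers i w = {p} \<and> down_crossers i w = {r} \<and> p < q \<and> q \<le> i \<and> w q \<le> i \<and> w r < w q)"

text \<open>The invariant after \<open>k\<close> letters \<open>i\<close> of a reduced word. From
  three on, only a pattern is recorded, since it persists under all later letters.\<close>

definition crossing_state :: "nat \<Rightarrow> nat \<Rightarrow> (nat \<Rightarrow> nat) \<Rightarrow> bool" where
  "crossing_state i k w \<longleftrightarrow>
     (if k = 0 then up_crossers i w = {} \<and> down_crossers i w = {}
      else if k = 1 then one_crossing i w
      else if k = 2 then two_crossings i w \<or> upper_detour i w \<or> lower_detour i w
      else pat4 w \<or> pat6 w)"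

text \<open>Position \<open>q\<close> stays beyond the line as \<open>j \<noteq> i\<close>, and
  \<open>q < r\<close> survives because \<open>(q, r)\<close> is an inversion.\<close>

lemma upper_detour_other:
  assumes "upper_detour i w" "w j < w (Suc j)" "j \<noteq> i"
  shows "upper_detour i (w \<circ> simple_transp j)"
proof -
  obtain p q r where *: "up_crossers i w = {p}" "down_crossers i w = {r}" "i < q" "q < r" "i < w q" "w q < w p"
    using assms(1) by (auto simp: upper_detour_def)
  then have "w r \<le> i" by (auto simp: down_crossers_def)
  then have "inverted w q r" using * by (simp add: inverted_def)
  from inverted_ascent[OF this assms(2)] * assms(3) show ?thesis
    unfolding upper_detour_def crossers_comp_other[OF assms(3)]
    by - (rule exI[of _ "simple_transp j p"], rule exI[of _ "simple_transp j q"], rule exI[of _ "simple_transp j r"],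
          (auto simp: inverted_def))
qed

lemma lower_detour_other:
  assumes "lower_detour i w" "w j < w (Suc j)" "j \<noteq> i"
  shows "lower_detour i (w \<circ> simple_transp j)"
proof -
  obtain p q r where *: "up_crossers i w = {p}" "down_crossers i w = {r}" "p < q" "q \<le> i" "w q \<le> i" "w r < w q"
    using assms(1) by (auto simp: lower_detour_def)
  then have "i < w p" by (auto simp: up_crossers_def)
  then have "inverted w p q" using * by (simp add: inverted_def)
  from inverted_ascent[OF this assms(2)] * assms(3) show ?thesis
    unfolding lower_detour_def crossers_comp_other[OF assms(3)]
    by - (rule exI[of _ "simple_transp j p"], rule exI[of _ "simple_transp j q"], rule exI[of _ "simple_transp j r"],
          (auto simp: inverted_def))
qed

lemma two_crossings_other:
  assumes "two_crossings i w" "j \<noteq> i"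
  shows "two_crossings i (w \<circ> simple_transp j)"
proof -
  obtain p p' q q' where "p \<noteq> p'" "q \<noteq> q'" "up_crossers i w = {p, p'}" "down_crossers i w = {q, q'}"
    using assms(1) by (auto simp: two_crossings_def)
  then show ?thesis
    unfolding two_crossings_def crossers_comp_other[OF assms(2)]
    by - (rule exI[of _ "simple_transp j p"], rule exI[of _ "simple_transp j p'"], rule exI[of _ "simple_transp j q"],
          rule exI[of _ "simple_transp j q'"], simp)
qed

lemma crossing_state_other:
  assumes "crossing_state i k w" "w j < w (Suc j)" "j \<noteq> i"
  shows "crossing_state i k (w \<circ> simple_transp j)"
proof -
  have "one_crossing i w \<Longrightarrow> one_crossing i (w \<circ> simple_transp j)"
    unfolding one_crossing_def crossers_comp_other[OF assms(3)] by auto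
  with assms show ?thesis
    using upper_detour_other[OF _ assms(2,3)] lower_detour_other[OF _ assms(2,3)]
      two_crossings_other[OF _ assms(3)] pat4_ascent[OF _ assms(2)] pat6_ascent[OF _ assms(2)]
      crossers_comp_other[OF assms(3)]
    unfolding crossing_state_def by (metis image_empty)
qed

lemma one_crossing_step:
  assumes "one_crossing i w" "w i < w (Suc i)"
  shows "two_crossings i (w \<circ> simple_transp i) \<or> upper_detour i (w \<circ> simple_transp i) \<or>
    lower_detour i (w \<circ> simple_transp i)"
proof -
  let ?v = "w \<circ> simple_transp i"
  obtain p q where pq: "up_crossers i w = {p}" "down_crossers i w = {q}"
    using assms(1) by (auto simp: one_crossing_def)
  then have b: "p \<le> i" "i < w p" "i < q" "w q \<le> i"
    by (auto simp: up_crossers_def down_crossers_def)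
  \<comment> \<open>Having both \<open>p = i\<close> and \<open>q = Suc i\<close> would make
    \<open>i\<close> a descent. If only one holds, a crossed entry returns and leaves a detour; if
    neither, a new pair crosses.\<close>
  consider "p = i" "q \<noteq> Suc i" | "p \<noteq> i" "q = Suc i" | "p \<noteq> i" "q \<noteq> Suc i"
    using b assms(2) by fastforce
  then show ?thesis
  proof cases
    case 1
    then have "upper_detour i ?v"
      unfolding upper_detour_def crossers_comp_same pq
      using b assms(2) by - (rule exI[of _ i], rule exI[of _ "Suc i"], rule exI[of _ q], auto)
    then show ?thesis by blast
  next
    case 2
    then have "lower_detour i ?v"
      unfolding lower_detour_def crossers_comp_same pq
      using b assms(2) by - (rule exI[of _ p], rule exI[of _ i], rule exI[of _ "Suc i"], auto)
    then show ?thesis by blast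
  next
    case 3
    then have "two_crossings i ?v"
      unfolding two_crossings_def crossers_comp_same pq
      by - (rule exI[of _ p], rule exI[of _ i], rule exI[of _ q],
            rule exI[of _ "Suc i"], auto)
    then show ?thesis by blast
  qed
qed

lemma pat4I:
  "a < b \<Longrightarrow> b < c \<Longrightarrow> c < d \<Longrightarrow> w c < w a \<Longrightarrow> w c < w b \<Longrightarrow> w d < w a \<Longrightarrow> w d < w b \<Longrightarrow>
   w b < w a \<or> w d < w c \<Longrightarrow> pat4 w"
  unfolding pat4_def inverted_def
  by - (rule exI[of _ a], rule exI[of _ b], rule exI[of _ c],
        rule exI[of _ d], auto)

lemma two_crossings_step:
  assumes "two_crossings i w" "w i < w (Suc i)"
  shows "pat4 (w \<circ> simple_transp i) \<or> pat6 (w \<circ> simple_transp i)"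
proof -
  let ?v = "w \<circ> simple_transp i"
  obtain p p' q q' where d: "p \<noteq> p'" "q \<noteq> q'"
    and *: "up_crossers i w = {p, p'}" "down_crossers i w = {q, q'}"
    using assms(1) by (auto simp: two_crossings_def)
  have m: "\<And>x. x \<in> {p, p'} \<Longrightarrow> x \<le> i \<and> i < w x" "\<And>x. x \<in> {q, q'} \<Longrightarrow> i < x \<and> w x \<le> i"
    unfolding *[symmetric] by (auto simp: up_crossers_def down_crossers_def)
  then have b: "p \<le> i" "i < w p" "p' \<le> i" "i < w p'" "i < q" "w q \<le> i" "i < q'" "w q' \<le> i"
    by auto
  have I: "inverted ?v x y" if "x \<in> up_crossers i ?v" "y \<in> down_crossers i ?v" for x y
    using that by (rule crossers_inverted)
  \<comment> \<open>If \<open>i\<close> is an up crosser, the ascent makes \<open>w (Suc i)\<close>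
    larger still, so two decreasing large entries precede two small ones; the second case is dual.
    Otherwise a third entry crosses each way.\<close>
  consider "i \<in> {p, p'}" | "Suc i \<in> {q, q'}" | "i \<notin> {p, p'}" "Suc i \<notin> {q, q'}" by blast
  then show ?thesis
  proof cases
    case 1
    then have "i < w i" using m by blast
    moreover then have "q \<noteq> Suc i" "q' \<noteq> Suc i" using assms(2) b by auto
    ultimately have "pat4 ?v"
      unfolding pat4_def inverted_def using d b assms(2)
      by - (rule exI[of _ i], rule exI[of _ "Suc i"], rule exI[of _ q],
            rule exI[of _ q'], auto)
    then show ?thesis ..
  next
    case 2
    then have "w (Suc i) \<le> i" using m by blast
    moreover then have "p \<noteq> i" "p' \<noteq> i" using assms(2) b by auto
    ultimately have "pat4 ?v"
      unfolding pat4_def inverted_def using d b assms(2)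
      by - (rule exI[of _ p], rule exI[of _ p'], rule exI[of _ i],
            rule exI[of _ "Suc i"], auto)
    then show ?thesis ..
  next
    case 3
    then have "up_crossers i ?v = {p, p', i}" "down_crossers i ?v = {q, q', Suc i}"
      unfolding crossers_comp_same * by auto
    note I' = I[unfolded this]
    have "pat6 ?v" by (rule pat6I[OF _ _ I']) (use d 3 in auto)
    then show ?thesis ..
  qed
qed

lemma upper_detour_step:
  assumes "upper_detour i w" "w i < w (Suc i)" "inj w"
  shows "pat4 (w \<circ> simple_transp i)"
proof -
  let ?v = "w \<circ> simple_transp i"
  obtain p q r where *: "up_crossers i w = {p}" "down_crossers i w = {r}" "i < q" "q < r" "i < w q" "w q < w p"
    using assms(1) by (auto simp: upper_detour_def)
  have b: "p \<le> i" "i < w p" "i < r" "w r \<le> i"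
    using *(1,2) by (auto simp: up_crossers_def down_crossers_def)
  have up: "i < w x \<longleftrightarrow> x = p" if "x \<le> i" for x
    using *(1) that by (simp add: up_crossers_def set_eq_iff) blast
  have down: "w x \<le> i \<longleftrightarrow> x = r" if "i < x" for x
    using *(2) that by (simp add: down_crossers_def set_eq_iff) blast
  have i: "w i \<le> i" if "i \<noteq> p" using that up[of i] by simp
  have Si: "i < w (Suc i)" using down[of "Suc i"] * by simp
  \<comment> \<open>In case 1 all four entries used decrease. In cases 2 and 4 the entry brought to
    \<open>i\<close> is large but below \<open>w p\<close>, so the first two decrease; in case 3 it
    exceeds \<open>w p\<close>, and the descent needed is the one from \<open>q\<close> to
    \<open>r\<close>.\<close>
  consider "p = i" | "p < i" "q = Suc i" | "p < i" "Suc i < q" "w p < w (Suc i)"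
    | "p < i" "Suc i < q" "w (Suc i) < w p"
    using b * injD[OF assms(3), of p "Suc i"] by fastforce
  then show ?thesis
  proof cases
    case 1
    then have "Suc i < q" using * assms(2) by (intro Suc_lessI) auto
    then show ?thesis using 1 * b assms(2) by (intro pat4I[of i "Suc i" q r]) auto
  next
    case 2
    then show ?thesis using * b i by (intro pat4I[of p i "Suc i" r]) auto
  next
    case 3
    then show ?thesis using * b i by (intro pat4I[of p i q r]) auto
  next
    case 4
    then show ?thesis using * b i Si by (intro pat4I[of p i "Suc i" r]) auto
  qed
qed

text \<open>The mirror image of the upper detour under reversing both positions and values, which
  exchanges the roles of \<open>p\<close> and \<open>r\<close>.\<close>

lemma lower_detour_step:
  assumes "lower_detour i w" "w i < w (Suc i)" "inj w"
  shows "pat4 (w \<circ> simple_transp i)"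
proof -
  let ?v = "w \<circ> simple_transp i"
  obtain p q r where *: "up_crossers i w = {p}" "down_crossers i w = {r}" "p < q" "q \<le> i" "w q \<le> i" "w r < w q"
    using assms(1) by (auto simp: lower_detour_def)
  have b: "p \<le> i" "i < w p" "i < r" "w r \<le> i"
    using *(1,2) by (auto simp: up_crossers_def down_crossers_def)
  have up: "i < w x \<longleftrightarrow> x = p" if "x \<le> i" for x
    using *(1) that by (simp add: up_crossers_def set_eq_iff) blast
  have down: "w x \<le> i \<longleftrightarrow> x = r" if "i < x" for x
    using *(2) that by (simp add: down_crossers_def set_eq_iff) blast
  have i: "w i \<le> i" using up[of i] * by simp
  have Si: "i < w (Suc i)" if "r \<noteq> Suc i" using down[of "Suc i"] that by simp
  consider "r = Suc i" | "Suc i < r" "q = i" | "Suc i < r" "q < i" "w r < w i"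
    | "Suc i < r" "q < i" "w i < w r"
    using b * injD[OF assms(3), of r i] by fastforce
  then show ?thesis
  proof cases
    case 1
    then have "q < i" using * assms(2) by (intro le_neq_implies_less) auto
    then show ?thesis using 1 * b assms(2) by (intro pat4I[of p q i "Suc i"]) auto
  next
    case 2
    then show ?thesis using * b Si by (intro pat4I[of p i "Suc i" r]) auto
  next
    case 3
    then show ?thesis using * b i Si by (intro pat4I[of p i "Suc i" r]) auto
  next
    case 4
    then show ?thesis using * b i Si by (intro pat4I[of p q "Suc i" r]) auto
  qed
qed

lemma crossing_state_same:
  assumes "crossing_state i k w" "w i < w (Suc i)" "inj w"
  shows "crossing_state i (Suc k) (w \<circ> simple_transp i)"
proof -
  have "one_crossing i (w \<circ> simple_transp i)" if "up_crossers i w = {}" "down_crossers i w = {}"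
    unfolding one_crossing_def crossers_comp_same that by auto
  then show ?thesis
    using assms(1) one_crossing_step[OF _ assms(2)] two_crossings_step[OF _ assms(2)]
      upper_detour_step[OF _ assms(2,3)] lower_detour_step[OF _ assms(2,3)]
      pat4_ascent[OF _ assms(2)] pat6_ascent[OF _ assms(2)]
    unfolding crossing_state_def by (auto split: if_splits simp del: o_apply)
qed

text \<open>Every letter of a reduced word acts at an ascent of the product before it, so a letter
  \<open>i\<close> advances the state and any other letter keeps it. The identity starts with no
  crossers.\<close>

lemma reduced_word_crossing_state:
  "w permutes {1..n} \<Longrightarrow> reduced_word n w is \<Longrightarrow> crossing_state i (count_list is i) w"
proof (induction "is" arbitrary: w rule: rev_induct)
  case Nil
  then have "w = id" by (simp only: reduced_word_def is_word_of_def word_prod_Nil)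
  then show ?case by (auto simp: crossing_state_def up_crossers_def down_crossers_def)
next
  case (snoc j "is")
  let ?u = "w \<circ> simple_transp j"
  note r = reduced_word_snocD[OF snoc.prems]
  have u: "?u permutes {1..n}" by (rule comp_simple_transp_permutes[OF snoc.prems(1) r(1)])
  have asc: "?u j < ?u (Suc j)" using r(2) by simp
  note IH = snoc.IH[OF u r(3)]
  show ?case
  proof (cases "j = i")
    case True
    with crossing_state_same[OF IH _ permutes_inj[OF u]] asc show ?thesis
      unfolding simple_transp_idem by simp
  next
    case False
    with crossing_state_other[OF IH asc] show ?thesis unfolding simple_transp_idem by simp
  qed
qed

lemma k_boolean_2_iff:
  assumes "w permutes {1..n}"
  shows "k_boolean 2 n w \<longleftrightarrow> \<not> pat4 w \<and> \<not> pat6 w"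
proof
  assume k: "k_boolean 2 n w"
  show "\<not> pat4 w \<and> \<not> pat6 w"
  proof (rule ccontr)
    assume "\<not> ?thesis"
    then obtain i "is" where "is": "reduced_word n w is" "3 \<le> count_list is i"
      using pat_occurs[OF assms] unfolding occurs_in_reduced_def by blast
    \<comment> \<open>\<open>occurs_in_reduced\<close> leaves \<open>i\<close> arbitrary; a letter
      that occurs lies in the range required by \<open>k_boolean\<close>.\<close>
    then have "i \<in> set is" using count_notin[of i "is"] by fastforce
    then have "i \<in> {1..<n}" using "is"(1) by (auto simp: reduced_word_def is_word_of_def)
    moreover have "2 < count_list is i" using "is"(2) by simp
    ultimately show False using k "is"(1) unfolding k_boolean_def by blast
  qed
next
  assume "\<not> pat4 w \<and> \<not> pat6 w"
  then show "k_boolean 2 n w"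
    unfolding k_boolean_def using reduced_word_crossing_state[OF assms]
    unfolding crossing_state_def by (metis less_numeral_extra(3) less_irrefl not_numeral_less_one zero_less_numeral less_asym)
qed

section \<open>Translation into classical pattern containment\<close>

lemma atLeastAtMost_4_6: "{1..4} = {1, 2, 3, 4 :: nat}" "{1..6} = {1, 2, 3, 4, 5, 6 :: nat}"
  by auto

text \<open>\<open>one_line\<close> is reused here for lists of positions, to build the embedding
  \<open>r\<close> of a pattern occurrence.\<close>

lemma one_line_strict_mono_on:
  "sorted_wrt (<) ps \<Longrightarrow> length ps = m \<Longrightarrow> strict_mono_on {1..m} (one_line ps)"
  by (auto simp: strict_mono_on_def one_line_def sorted_wrt_iff_nth_less)

lemma contains_pattern_4_iff:
  "contains_pattern n w 4 p \<longleftrightarrow>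
     (\<exists>a b c d. a \<in> {1..n} \<and> d \<in> {1..n} \<and> a < b \<and> b < c \<and> c < d \<and>
        (\<forall>(x, k) \<in> {(a, 1), (b, 2), (c, 3), (d, 4)}. \<forall>(y, l) \<in> {(a, 1), (b, 2), (c, 3), (d, 4)}.
           w x < w y \<longleftrightarrow> p k < p l))"
  (is "_ = (\<exists>a b c d. ?R a b c d)")
proof
  assume "contains_pattern n w 4 p"
  then obtain r where "r ` {1..4} \<subseteq> {1..n}" "strict_mono_on {1..4} r"
    "\<forall>a\<in>{1..4}. \<forall>b\<in>{1..4}. w (r a) < w (r b) \<longleftrightarrow> p a < p b"
    unfolding contains_pattern_def by blast
  then have "?R (r 1) (r 2) (r 3) (r 4)"
    unfolding atLeastAtMost_4_6 strict_mono_on_def by simp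
  then show "\<exists>a b c d. ?R a b c d" by blast
next
  assume "\<exists>a b c d. ?R a b c d"
  then obtain a b c d where R: "?R a b c d" by blast
  let ?r = "one_line [a, b, c, d]"
  have r: "?r 1 = a" "?r 2 = b" "?r 3 = c" "?r 4 = d" by (simp_all add: one_line_def)
  have "strict_mono_on {1..4} ?r"
    using R by (intro one_line_strict_mono_on) auto
  moreover have "?r ` {1..4} \<subseteq> {1..n}"
    unfolding atLeastAtMost_4_6 using R r by auto
  moreover have "\<forall>x\<in>{1..4}. \<forall>y\<in>{1..4}. w (?r x) < w (?r y) \<longleftrightarrow> p x < p y"
    unfolding atLeastAtMost_4_6 using R r by simp
  ultimately show "contains_pattern n w 4 p" unfolding contains_pattern_def by blast
qed

lemma contains_pattern_one_line_4_iff: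
  "contains_pattern n w 4 (one_line [s, t, u, v]) \<longleftrightarrow>
     (\<exists>a b c d. a \<in> {1..n} \<and> d \<in> {1..n} \<and> a < b \<and> b < c \<and> c < d \<and>
        (\<forall>(x, k) \<in> {(a, s), (b, t), (c, u), (d, v)}. \<forall>(y, l) \<in> {(a, s), (b, t), (c, u), (d, v)}.
           w x < w y \<longleftrightarrow> k < l))"
  by (simp add: contains_pattern_4_iff one_line_def)

lemma pat4_iff_contains:
  assumes "w permutes {1..n}"
  shows "pat4 w \<longleftrightarrow> contains_pattern n w 4 (one_line [3, 4, 2, 1]) \<or>
    contains_pattern n w 4 (one_line [4, 3, 1, 2]) \<or> contains_pattern n w 4 (one_line [4, 3, 2, 1])"
    (is "_ \<longleftrightarrow> ?R")
proof
  assume "pat4 w"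
  then obtain a b c d where o: "a < b" "b < c" "c < d" and
    v: "w c < w a" "w c < w b" "w d < w a" "w d < w b" "w b < w a \<or> w d < w c"
    using pat4_sorted by metis
  have "inverted w a d" using o v by (simp add: inverted_def)
  note rng = inverted_in_range[OF assms this]
  have ne: "w a \<noteq> w b" "w c \<noteq> w d" using o permutes_inj[OF assms] by (auto dest: injD)
  \<comment> \<open>These are the three relative orders left open, corresponding to 3421, 4312 and
    4321 in turn.\<close>
  consider "w a < w b" "w d < w c" | "w b < w a" "w c < w d" | "w b < w a" "w d < w c"
    using v(5) ne by linarith
  then show ?R
  proof cases
    case 1
    have "contains_pattern n w 4 (one_line [3, 4, 2, 1])"
      unfolding contains_pattern_one_line_4_iff
      by (rule exI[of _ a], rule exI[of _ b], rule exI[of _ c], rule exI[of _ d]) (use o v rng 1 in simp)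
    then show ?thesis by blast
  next
    case 2
    have "contains_pattern n w 4 (one_line [4, 3, 1, 2])"
      unfolding contains_pattern_one_line_4_iff
      by (rule exI[of _ a], rule exI[of _ b], rule exI[of _ c], rule exI[of _ d]) (use o v rng 2 in simp)
    then show ?thesis by blast
  next
    case 3
    have "contains_pattern n w 4 (one_line [4, 3, 2, 1])"
      unfolding contains_pattern_one_line_4_iff
      by (rule exI[of _ a], rule exI[of _ b], rule exI[of _ c], rule exI[of _ d]) (use o v rng 3 in simp)
    then show ?thesis by blast
  qed
next
  assume ?R
  then obtain s t u v where "contains_pattern n w 4 (one_line [s, t, u, v])"
    and *: "u < s" "u < t" "v < s" "v < t" "t < s \<or> v < u"
    by (elim disjE) (rule that, assumption, simp_all)+
  then obtain a b c d where "a < b" "b < c" "c < d" and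
    "\<forall>(x, k) \<in> {(a, s), (b, t), (c, u), (d, v)}. \<forall>(y, l) \<in> {(a, s), (b, t), (c, u), (d, v)}.
      w x < w y \<longleftrightarrow> k < l"
    unfolding contains_pattern_one_line_4_iff by blast
  then show "pat4 w" using * by (intro pat4I[of a b c d w]) simp_all
qed

lemma contains_456123_imp_pat6:
  assumes "contains_pattern n w 6 (one_line [4, 5, 6, 1, 2, 3])"
  shows "pat6 w"
proof -
  let ?p = "one_line [4, 5, 6, 1, 2, 3]"
  obtain r where r: "strict_mono_on {1..6} r"
    "\<forall>a\<in>{1..6}. \<forall>b\<in>{1..6}. w (r a) < w (r b) \<longleftrightarrow> ?p a < ?p b"
    using assms unfolding contains_pattern_def by blast
  have p: "?p 1 = 4" "?p 2 = 5" "?p 3 = 6" "?p 4 = 1" "?p 5 = 2" "?p 6 = 3"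
    by (simp_all add: one_line_def)
  have I: "inverted w (r x) (r y)" if xy: "x \<in> {1, 2, 3}" "y \<in> {4, 5, 6}" for x y
  proof -
    have *: "x \<in> {1..6}" "y \<in> {1..6}" "x < y" "?p y < ?p x" using xy p by auto
    then show ?thesis
      using strict_mono_onD[OF r(1) *(1-3)] r(2) by (simp add: inverted_def)
  qed
  have inj: "inj_on r {1..6}" by (rule strict_mono_on_imp_inj_on[OF r(1)])
  show ?thesis
  proof (rule pat6I)
    show "distinct [r 1, r 2, r 3]" "distinct [r 4, r 5, r 6]"
      by (simp_all add: inj_on_eq_iff[OF inj])
  qed (use I in blast)
qed

lemma pat6_imp_contains:
  assumes w: "w permutes {1..n}" and "pat6 w" "\<not> pat4 w"
  shows "contains_pattern n w 6 (one_line [4, 5, 6, 1, 2, 3])"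
proof -
  obtain a b c d e f where o: "a < b" "b < c" "c < d" "d < e" "e < f" and
    v: "\<And>x y. x \<in> {a, b, c} \<Longrightarrow> y \<in> {d, e, f} \<Longrightarrow> w y < w x"
    using pat6_sorted[OF assms(2)] by metis
  have "inverted w a f" using o v[of a f] by (simp add: inverted_def)
  note rng = inverted_in_range[OF w this]
  have v': "w d < w a" "w d < w b" "w d < w c" "w e < w a" "w e < w b" "w e < w c"
    "w f < w a" "w f < w b" "w f < w c" using v by auto
  \<comment> \<open>A descent within one triple, together with two entries of the other, would be a
    \<open>pat4\<close>. So both triples ascend and the pattern is exactly 456123.\<close>
  have "\<not> w b < w a" "\<not> w c < w b" "\<not> w e < w d" "\<not> w f < w e"
    using assms(3) pat4I[of a b d e w] pat4I[of b c d e w] pat4I[of a b e f w] o v' by fastforce+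
  moreover have "w a \<noteq> w b" "w b \<noteq> w c" "w d \<noteq> w e" "w e \<noteq> w f"
    using o inj_eq[OF permutes_inj[OF w]] by auto
  ultimately have as: "w a < w b" "w b < w c" "w d < w e" "w e < w f" by linarith+
  let ?r = "one_line [a, b, c, d, e, f]" and ?p = "one_line [4, 5, 6, 1, 2, 3]"
  have r: "?r 1 = a" "?r 2 = b" "?r 3 = c" "?r 4 = d" "?r 5 = e" "?r 6 = f"
    and p: "?p 1 = 4" "?p 2 = 5" "?p 3 = 6" "?p 4 = 1" "?p 5 = 2" "?p 6 = 3"
    by (simp_all add: one_line_def)
  have "strict_mono_on {1..6} ?r"
    using o by (intro one_line_strict_mono_on) auto
  moreover have "?r ` {1..6} \<subseteq> {1..n}"
    unfolding atLeastAtMost_4_6 using rng o r by simp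
  moreover have "\<forall>x\<in>{1..6}. \<forall>y\<in>{1..6}. w (?r x) < w (?r y) \<longleftrightarrow> ?p x < ?p y"
    unfolding atLeastAtMost_4_6 using as v' r p by simp
  ultimately show ?thesis unfolding contains_pattern_def by blast
qed

theorem theorem4p2:
  fixes n :: nat and w :: "nat \<Rightarrow> nat"
  assumes "w permutes {1..n}"
  shows "k_boolean 2 n w \<longleftrightarrow>
           avoids_pattern n w 4 (one_line [3, 4, 2, 1]) \<and>
           avoids_pattern n w 4 (one_line [4, 3, 1, 2]) \<and>
           avoids_pattern n w 4 (one_line [4, 3, 2, 1]) \<and>
           avoids_pattern n w 6 (one_line [4, 5, 6, 1, 2, 3])"
  unfolding avoids_pattern_def k_boolean_2_iff[OF assms]
  using pat4_iff_contains[OF assms] contains_456123_imp_pat6 pat6_imp_contains[OF assms] by blast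

end
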